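(* Let $n\ge 2$, let $1\le k\le n-1$ and $0\le r\le n-k$, and let $\omega=(r+1\ \, r+2\ \cdots\ r+k\mid \cdots)$ be the corresponding admissible shuffle of $\{1,\dots,n\}$. For any planar binary tree $t\in Y_n$, the point $M(t)$ lies in the hyperplane $\mathcal{H}_\omega$ if and only if $t$ is a refinement of the planar tree $y(r,k)$ corresponding to $\omega$. If $t$ is not a refinement of $y(r,k)$, then $p_\omega(M(t))>0$.
   Context: $Y_n$ is the set of planar rooted binary trees with $n+1$ leaves (so $n$ internal vertices). Label the leaves of $t\in Y_n$ from left to right by $0,1,\dots,n$, and the internal vertices by $1,\dots,n$ so that the $i$th vertex is the one which falls in between the leaves $i-1$ and $i$ (leaf $i-1$ is the rightmost leaf of its left subtree and leaf $i$ the leftmost leaf of its right subtree). Let $a_i$ (resp. $b_i$) be the number of leaves of the left (resp. right) subtree at the $i$th vertex, and $M(t)=(a_1b_1,\dots,a_nb_n)\in\mathbb{R}^n$. A shuffle $\omega=(\omega_1\cdots\omega_k\mid\omega_{k+1}\cdots\omega_n)$ is a partition of $\{1,\dots,n\}$ into an ordered pair of nonempty subsets, written with $\omega_1<\cdots<\omega_k$ and $\omega_{k+1}<\cdots<\omega_n$. It is called admissible if the first part is a sequence of consecutive integers $r+1,r+2,\dots,r+k$. To $\omega$ one associates the polynomial $$p_\omega(x_1,\dots,x_n)=(n-k)(x_{\omega_1}+\cdots+x_{\omega_k})-k(x_{\omega_{k+1}}+\cdots+x_{\omega_n})+\tfrac12 nk(n-k)$$ and the hyperplane $\mathcal{H}_\omega=\{x\in\mathbb{R}^n: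 p_\omega(x)=0\}$. The tree $y(r,k)$ corresponding to the admissible shuffle $(r+1\cdots r+k\mid\cdots)$ is the planar tree with leaves $0,\dots,n$ and exactly two internal vertices: a root vertex and one other vertex, joined by the unique internal edge, where the leaves attached to the non-root vertex are exactly $r,r+1,\dots,r+k$ and all the other leaves are attached to the root vertex. A planar tree $t$ is a refinement of a planar tree $t'$ if $t'$ can be obtained from $t$ by contracting to a point some of the internal edges. *)

theory Defs
  imports Complex_Main "HOL-Library.FuncSet"
begin

section \<open>Planar rooted trees\<close>

text \<open>Leaves carry labels, so that the subtrees of a tree whose leaves are labelled without
  repetition are in bijection with its vertices. A planar tree with \<open>n + 1\<close> leaves is represented
  by the tree whose leaves, read from left to right, are labelled \<open>0, \<dots>, n\<close>.\<close>

datatype ptree = Leaf nat | Node "ptree list"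

fun leaves :: "ptree \<Rightarrow> nat list" where
  "leaves (Leaf i) = [i]"
| "leaves (Node ts) = concat (map leaves ts)"

fun subtrees :: "ptree \<Rightarrow> ptree set" where
  "subtrees (Leaf i) = {Leaf i}"
| "subtrees (Node ts) = insert (Node ts) (\<Union>t\<in>set ts. subtrees t)"

inductive binary :: "ptree \<Rightarrow> bool" where
  "binary (Leaf i)"
| "binary l \<Longrightarrow> binary r \<Longrightarrow> binary (Node [l, r])"

definition Y :: "nat \<Rightarrow> ptree set" where
  "Y n = {t. binary t \<and> leaves t = [0..<n + 1]}"

text \<open>Contraction of one internal edge: the children of the lower vertex take its place among
  the children of the upper vertex.\<close>

inductive contract_edge :: "ptree \<Rightarrow> ptree \<Rightarrow> bool" where
  here: "contract_edge (Node (us @ Node ts # vs)) (Node (us @ ts @ vs))"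
| below: "contract_edge t t' \<Longrightarrow> contract_edge (Node (us @ t # vs)) (Node (us @ t' # vs))"

definition refines :: "ptree \<Rightarrow> ptree \<Rightarrow> bool" where
  "refines t t' \<longleftrightarrow> contract_edge\<^sup>*\<^sup>* t t'"

definition y :: "nat \<Rightarrow> nat \<Rightarrow> nat \<Rightarrow> ptree" where
  "y n r k = Node (map Leaf [0..<r] @ [Node (map Leaf [r..<r + k + 1])]
                   @ map Leaf [r + k + 1..<n + 1])"


section \<open>The point of a planar binary tree\<close>

text \<open>The left and right subtrees at the vertex falling between the leaves \<open>i - 1\<close> and \<open>i\<close>.\<close>

definition vertex :: "ptree \<Rightarrow> nat \<Rightarrow> ptree \<times> ptree" where
  "vertex t i = (THE (l, r). Node [l, r] \<in> subtrees t \<and>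
                             Suc (last (leaves l)) = i \<and> hd (leaves r) = i)"

lemma binary_leaves_nonempty: "binary t \<Longrightarrow> leaves t \<noteq> []"
  by (induction rule: binary.induct) auto

lemma subtree_binary: "binary t \<Longrightarrow> s \<in> subtrees t \<Longrightarrow> binary s \<and> set (leaves s) \<subseteq> set (leaves t)"
  by (induction rule: binary.induct) (auto intro: binary.intros)

lemma upt_append_split:
  assumes "xs @ ys = [a..<b]" "xs \<noteq> []" "ys \<noteq> []"
  shows "\<exists>m. a < m \<and> m < b \<and> xs = [a..<m] \<and> ys = [m..<b]"
proof -
  have l: "length xs + length ys = b - a" using assms(1) by (metis length_append length_upt)
  have pos: "length xs > 0" "length ys > 0" using assms by auto
  have "xs = take (length xs) [a..<b]" "ys = drop (length xs) [a..<b]"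
    unfolding assms(1)[symmetric] by auto
  moreover have "take (length xs) [a..<b] = [a..<a + length xs]"
    using l pos by (intro take_upt) linarith
  ultimately show ?thesis using l pos
    by (intro exI[of _ "a + length xs"]) (auto simp: drop_upt)
qed

lemma vertex_unique_aux:
  assumes "binary t" "leaves t = [a..<b]" "a < i" "i < b"
  shows "\<exists>!(l, r). Node [l, r] \<in> subtrees t \<and> Suc (last (leaves l)) = i \<and> hd (leaves r) = i"
  using assms
proof (induction t arbitrary: a b rule: binary.induct)
  case (1 j)
  have "length [a..<b] = 1" using 1(1) by (metis leaves.simps(1) length_Cons list.size(3) One_nat_def)
  with 1 show ?case by simp
next
  case (2 l r)
  have ne: "leaves l \<noteq> []" "leaves r \<noteq> []" using 2 binary_leaves_nonempty by auto
  have "leaves l @ leaves r = [a..<b]" using 2 by simp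
  from upt_append_split[OF this ne] obtain m where
    m: "a < m" "m < b" "leaves l = [a..<m]" "leaves r = [m..<b]" by blast
  have L: "hd (leaves r') < m"
    if "Node [l', r'] \<in> subtrees l" for l' r'
  proof -
    have "binary (Node [l', r'])" and s: "set (leaves (Node [l', r'])) \<subseteq> {a..<m}"
      using subtree_binary[OF 2(1) that] m by auto
    then have "binary r'" by (auto elim: binary.cases)
    then have "hd (leaves r') \<in> set (leaves r')"
      using binary_leaves_nonempty by auto
    then show ?thesis using s by auto
  qed
  have R: "m \<le> last (leaves l')"
    if "Node [l', r'] \<in> subtrees r" for l' r'
  proof -
    have "binary (Node [l', r'])" and s: "set (leaves (Node [l', r'])) \<subseteq> {m..<b}"
      using subtree_binary[OF 2(2) that] m by auto
    then have "binary l'" by (auto elim: binary.cases)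
    then have "last (leaves l') \<in> set (leaves l')"
      using binary_leaves_nonempty by auto
    then show ?thesis using s by auto
  qed
  have lr: "last (leaves l) = m - 1" "hd (leaves r) = m" using m by auto
  have S: "Node [x, z] \<in> subtrees (Node [l, r]) \<longleftrightarrow>
      x = l \<and> z = r \<or> Node [x, z] \<in> subtrees l \<or> Node [x, z] \<in> subtrees r" for x z
    by auto
  consider "i < m" | "i = m" | "m < i" by linarith
  then show ?case
  proof cases
    case 1
    then have "Node [x, z] \<in> subtrees (Node [l, r]) \<and> Suc (last (leaves x)) = i \<and> hd (leaves z) = i
      \<longleftrightarrow> Node [x, z] \<in> subtrees l \<and> Suc (last (leaves x)) = i \<and> hd (leaves z) = i" for x z
      proof -
      have "Node [x, z] \<in> subtrees r \<Longrightarrow> Suc (last (leaves x)) \<noteq> i" using R[of x z] 1 by linarith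
      moreover have "hd (leaves r) \<noteq> i" using lr 1 by linarith
      ultimately show ?thesis unfolding S by blast
    qed
    then show ?thesis using "2.IH"(1)[OF m(3) 2(6) 1] by simp
  next
    case 2
    then have "Node [x, z] \<in> subtrees (Node [l, r]) \<and> Suc (last (leaves x)) = i \<and> hd (leaves z) = i
      \<longleftrightarrow> x = l \<and> z = r" for x z
      proof -
      have "Node [x, z] \<in> subtrees r \<Longrightarrow> Suc (last (leaves x)) \<noteq> i" using R[of x z] 2 by linarith
      moreover have "Node [x, z] \<in> subtrees l \<Longrightarrow> hd (leaves z) \<noteq> i" using L[of x z] 2 by linarith
      moreover have "hd (leaves r) = i" "Suc (last (leaves l)) = i" using lr m(1) 2 by linarith+
      ultimately show ?thesis unfolding S by blast
    qed
    then show ?thesis by auto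
  next
    case 3
    then have "Node [x, z] \<in> subtrees (Node [l, r]) \<and> Suc (last (leaves x)) = i \<and> hd (leaves z) = i
      \<longleftrightarrow> Node [x, z] \<in> subtrees r \<and> Suc (last (leaves x)) = i \<and> hd (leaves z) = i" for x z
      proof -
      have "Node [x, z] \<in> subtrees l \<Longrightarrow> hd (leaves z) \<noteq> i" using L[of x z] 3 by linarith
      moreover have "hd (leaves r) \<noteq> i" using lr 3 by linarith
      ultimately show ?thesis unfolding S by blast
    qed
    then show ?thesis using "2.IH"(2)[OF m(4) 3 2(7)] by simp
  qed
qed

lemma vertex_unique:
  assumes "t \<in> Y n" "i \<in> {1..n}"
  shows "\<exists>!(l, r). Node [l, r] \<in> subtrees t \<and> Suc (last (leaves l)) = i \<and> hd (leaves r) = i"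
  using assms by (intro vertex_unique_aux[of t 0 "n + 1"]) (auto simp: Y_def)

text \<open>\<open>\<real>\<^sup>n\<close> is the set of functions on \<open>{1..n}\<close>, extensional outside this set.\<close>

definition M :: "nat \<Rightarrow> ptree \<Rightarrow> nat \<Rightarrow> real" where
  "M n t = (\<lambda>i\<in>{1..n}. let (l, r) = vertex t i
                       in real (length (leaves l)) * real (length (leaves r)))"


section \<open>Shuffles\<close>

definition shuffles :: "nat \<Rightarrow> (nat set \<times> nat set) set" where
  "shuffles n = {(A, B). A \<noteq> {} \<and> B \<noteq> {} \<and> A \<inter> B = {} \<and> A \<union> B = {1..n}}"

definition admissible_shuffles :: "nat \<Rightarrow> (nat set \<times> nat set) set" where
  "admissible_shuffles n = {(A, B) \<in> shuffles n. \<exists>r k. A = {r + 1..r + k}}"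

definition interval_shuffle :: "nat \<Rightarrow> nat \<Rightarrow> nat \<Rightarrow> nat set \<times> nat set" where
  "interval_shuffle n r k = ({r + 1..r + k}, {1..n} - {r + 1..r + k})"

definition p :: "nat \<Rightarrow> nat set \<times> nat set \<Rightarrow> (nat \<Rightarrow> real) \<Rightarrow> real" where
  "p n \<omega> x = (let k = real (card (fst \<omega>)) in
     (real n - k) * (\<Sum>i\<in>fst \<omega>. x i) - k * (\<Sum>i\<in>snd \<omega>. x i) + 1 / 2 * real n * k * (real n - k))"

definition hyperplane :: "nat \<Rightarrow> nat set \<times> nat set \<Rightarrow> (nat \<Rightarrow> real) set" where
  "hyperplane n \<omega> = {x \<in> {1..n} \<rightarrow>\<^sub>E UNIV. p n \<omega> x = 0}"

lemma interval_shuffle_admissible: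
  assumes "1 \<le> k" "k < n" "r + k \<le> n"
  shows "interval_shuffle n r k \<in> admissible_shuffles n"
proof -
  have "{1..n} - {r + 1..r + k} \<noteq> {}"
  proof
    assume "{1..n} - {r + 1..r + k} = {}"
    then have "card {1..n} \<le> card {r + 1..r + k}" by (intro card_mono) auto
    with \<open>k < n\<close> show False by simp
  qed
  moreover have "{r + 1..r + k} \<noteq> {}" "{r + 1..r + k} \<subseteq> {1..n}" using assms by auto
  ultimately show ?thesis
    unfolding interval_shuffle_def admissible_shuffles_def shuffles_def by blast
qed

end

theory Submission imports Defs
begin

text \<open>The coordinates of \<open>M(t)\<close> add up to \<open>n(n+1)/2\<close>, so that \<open>p\<^sub>\<omega>(M(t))\<close> is \<open>n\<close> times the excess
  of \<open>M(t)\<^bsub>r+1\<^esub> + \<dots> + M(t)\<^bsub>r+k\<^esub>\<close> over \<open>k(k+1)/2\<close>. Induction on \<open>t\<close> shows that this excess is nonnegative,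
  and that it vanishes exactly if some subtree of \<open>t\<close> has the leaves \<open>r, \<dots>, r+k\<close>: if the root falls
  inside the interval and cuts it into pieces with \<open>c\<close> and \<open>d\<close> leaves, the root contributes at least
  \<open>cd\<close>, with equality exactly if \<open>t\<close> has no other leaves. Such a subtree exists exactly if \<open>t\<close> refines
  \<open>y(r,k)\<close>: contractions create no new leaf intervals, and conversely all internal edges of \<open>t\<close>
  other than the one above this subtree can be contracted.\<close>

section \<open>Subtrees and their vertices\<close>

lemma leaves_subset_subtree: "s \<in> subtrees t \<Longrightarrow> set (leaves s) \<subseteq> set (leaves t)"
  by (induction t) auto

lemma subtree_refl: "t \<in> subtrees t"
  by (cases t) auto

lemma subtrees_trans: "u \<in> subtrees s \<Longrightarrow> s \<in> subtrees t \<Longrightarrow> u \<in> subtrees t"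
  by (induction t) auto

text \<open>The coordinates of \<open>M\<close>, kept in \<open>nat\<close> and free of the range
  \<open>{1..n}\<close>, so that they also make sense for subtrees whose leaves do not start at
  0.\<close>

definition vertex_weight :: "ptree \<Rightarrow> nat \<Rightarrow> nat" where
  "vertex_weight t i = (let (l, r) = vertex t i in length (leaves l) * length (leaves r))"

lemma vertex_eqI:
  assumes "binary t" "leaves t = [a..<b]" "a < i" "i < b"
    and "Node [l, r] \<in> subtrees t" "Suc (last (leaves l)) = i" "hd (leaves r) = i"
  shows "vertex t i = (l, r)"
  unfolding vertex_def using vertex_unique_aux[OF assms(1-4)] assms(5-)
  by (intro the1_equality) auto

text \<open>The vertex found in \<open>s\<close> is also a vertex of \<open>t\<close>, and
  uniqueness in \<open>t\<close> identifies the two. This carries weights from a tree to its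
  children.\<close>

lemma vertex_in_subtree:
  assumes "binary t" "leaves t = [a..<b]" "binary s" "leaves s = [c..<d]"
    and "s \<in> subtrees t" "c < i" "i < d"
  shows "vertex t i = vertex s i"
proof -
  have "set [c..<d] \<subseteq> set [a..<b]"
    using leaves_subset_subtree[OF assms(5)] assms(2,4) by simp
  then have ab: "a < i" "i < b"
    using assms(6,7) by (auto simp: subset_iff dest: spec[of _ c] spec[of _ i])
  obtain l r where lr: "Node [l, r] \<in> subtrees s" "Suc (last (leaves l)) = i" "hd (leaves r) = i"
    using vertex_unique_aux[OF assms(3,4,6,7)] by auto
  have "vertex s i = (l, r)"
    using vertex_eqI[OF assms(3,4,6,7) lr] .
  moreover have "vertex t i = (l, r)"
    using vertex_eqI[OF assms(1,2) ab subtrees_trans[OF lr(1) assms(5)] lr(2,3)] .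
  ultimately show ?thesis by simp
qed

section \<open>Sums of weights over an interval\<close>

lemma mult_eq_imp_eq_nat:
  fixes a b c d :: nat
  assumes "a * b \<le> c * d" "c \<le> a" "d \<le> b" "0 < c" "0 < d"
  shows "a = c \<and> b = d"
proof -
  \<comment> \<open>Both chains from \<open>c * d\<close> up to \<open>a * b\<close> collapse to
    equalities, and the common positive factors cancel.\<close>
  have "c * d \<le> c * b" "c * b \<le> a * b" "c * d \<le> a * d" "a * d \<le> a * b"
    using assms by simp_all
  then have "a * b = c * b" "a * b = a * d" using assms(1) by linarith+
  then show ?thesis using assms by simp
qed

text \<open>Labels start at an arbitrary \<open>a\<close> so that the induction reaches both
  children. The value \<open>k = 0\<close> is included because the root may cut off a single leaf of
  the interval.\<close>

lemma sum_vertex_weight: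
  assumes "binary t" "leaves t = [a..<b]" "a \<le> r" "r + k < b"
  shows "k * (k + 1) \<le> 2 * (\<Sum>i\<in>{r<..r + k}. vertex_weight t i) \<and>
    (2 * (\<Sum>i\<in>{r<..r + k}. vertex_weight t i) = k * (k + 1) \<longleftrightarrow>
      (\<exists>s\<in>subtrees t. leaves s = [r..<r + k + 1]))"
  using assms
proof (induction t arbitrary: a b r k rule: binary.induct)
  case (1 j)
  then have "length [a..<b] = 1" "j \<in> set [a..<b]"
    by (metis leaves.simps(1) length_Cons list.size(3) One_nat_def, metis leaves.simps(1) list.set_intros(1))
  then have "k = 0" "r = j" using 1(2,3) by auto
  then show ?case by simp
next
  case (2 u v)
  let ?t = "Node [u, v]"
  have t: "binary ?t" using 2 by (intro binary.intros)
  have uv: "u \<in> subtrees ?t" "v \<in> subtrees ?t"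
    using subtree_refl by auto
  have ne: "leaves u \<noteq> []" "leaves v \<noteq> []" using 2 binary_leaves_nonempty by auto
  have "leaves u @ leaves v = [a..<b]" using 2 by simp
  from upt_append_split[OF this ne] obtain m where
    m: "a < m" "m < b" "leaves u = [a..<m]" "leaves v = [m..<b]" by blast
  have wu: "vertex_weight ?t i = vertex_weight u i" if "a < i" "i < m" for i
    unfolding vertex_weight_def
    using vertex_in_subtree[OF t 2(5) 2(1) m(3) uv(1) that] by simp
  have wv: "vertex_weight ?t i = vertex_weight v i" if "m < i" "i < b" for i
    unfolding vertex_weight_def
    using vertex_in_subtree[OF t 2(5) 2(2) m(4) uv(2) that] by simp
  have "vertex ?t m = (u, v)"
    using m by (intro vertex_eqI[OF t 2(5)]) auto
  then have wm: "vertex_weight ?t m = (m - a) * (b - m)"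
    unfolding vertex_weight_def using m by simp
  have u_sub: "set (leaves s) \<subseteq> {a..<m}" if "s \<in> subtrees u" for s
    using leaves_subset_subtree[OF that] m(3) by simp
  have v_sub: "set (leaves s) \<subseteq> {m..<b}" if "s \<in> subtrees v" for s
    using leaves_subset_subtree[OF that] m(4) by simp
  \<comment> \<open>A label \<open>x\<close> in exactly one of the two leaf sets separates the
    lists; below, \<open>x\<close> is \<open>m\<close>, \<open>a\<close> or
    \<open>r\<close>.\<close>
  have interval: "leaves s \<noteq> [r..<r + k + 1]"
    if "x \<in> set (leaves s) \<longleftrightarrow> x \<notin> {r..r + k}" for s x
    using that by (auto simp del: upt_Suc)
  consider "r + k < m" | "m \<le> r" | "r < m" "m \<le> r + k" by linarith
  then show ?case
  proof cases
    case 1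
    have "(\<exists>s\<in>subtrees ?t. leaves s = [r..<r + k + 1]) \<longleftrightarrow>
      (\<exists>s\<in>subtrees u. leaves s = [r..<r + k + 1])"
    proof -
      have "m \<in> set (leaves ?t)" unfolding \<open>leaves ?t = _\<close> using m by simp
      then have "leaves ?t \<noteq> [r..<r + k + 1]"
        using 1 by (intro interval[of m]) auto
      moreover have "leaves s \<noteq> [r..<r + k + 1]" if "s \<in> subtrees v" for s
        using v_sub[OF that] 1 by (intro interval[of r]) auto
      ultimately show ?thesis by auto
    qed
    moreover have "(\<Sum>i\<in>{r<..r + k}. vertex_weight ?t i) = (\<Sum>i\<in>{r<..r + k}. vertex_weight u i)"
      using 1 2(6) by (intro sum.cong) (auto intro: wu)
    ultimately show ?thesis using "2.IH"(1)[OF m(3) 2(6) 1] by simp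
  next
    case 2
    have "(\<exists>s\<in>subtrees ?t. leaves s = [r..<r + k + 1]) \<longleftrightarrow>
      (\<exists>s\<in>subtrees v. leaves s = [r..<r + k + 1])"
    proof -
      have "a \<in> set (leaves ?t)" unfolding \<open>leaves ?t = _\<close> using m by simp
      then have "leaves ?t \<noteq> [r..<r + k + 1]"
        using 2 m(1) by (intro interval[of a]) auto
      moreover have "leaves s \<noteq> [r..<r + k + 1]" if "s \<in> subtrees u" for s
        using u_sub[OF that] 2 by (intro interval[of r]) auto
      ultimately show ?thesis by auto
    qed
    moreover have "(\<Sum>i\<in>{r<..r + k}. vertex_weight ?t i) = (\<Sum>i\<in>{r<..r + k}. vertex_weight v i)"
      using 2 \<open>r + k < b\<close> by (intro sum.cong) (auto intro: wv)
    ultimately show ?thesis using "2.IH"(2)[OF m(4) 2 \<open>r + k < b\<close>] by simp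
  next
    case 3
    \<comment> \<open>\<open>c\<close> and \<open>d\<close> count the vertices of the interval to
      the left and right of \<open>m\<close>; the corresponding pieces have \<open>c + 1\<close> and
      \<open>d + 1\<close> leaves.\<close>
    define c d where "c = m - 1 - r" and "d = r + k - m"
    have m_eq: "m = r + c + 1" and k_eq: "k = c + 1 + d" using 3 by (simp_all add: c_def d_def)
    let ?S = "\<Sum>i\<in>{r<..r + k}. vertex_weight ?t i"
    let ?U = "\<Sum>i\<in>{r<..r + c}. vertex_weight u i"
    let ?V = "\<Sum>i\<in>{m<..m + d}. vertex_weight v i"
    have "{r<..r + k} = insert m ({r<..r + c} \<union> {m<..m + d})" by (auto simp: m_eq k_eq)
    then have "?S = vertex_weight ?t m + ((\<Sum>i\<in>{r<..r + c}. vertex_weight ?t i)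
        + (\<Sum>i\<in>{m<..m + d}. vertex_weight ?t i))"
      by (simp add: m_eq sum.union_disjoint)
    also have "(\<Sum>i\<in>{r<..r + c}. vertex_weight ?t i) = ?U"
      using \<open>a \<le> r\<close> by (intro sum.cong) (auto intro!: wu simp: m_eq)
    also have "(\<Sum>i\<in>{m<..m + d}. vertex_weight ?t i) = ?V"
      using \<open>r + k < b\<close> by (intro sum.cong) (auto intro!: wv simp: m_eq k_eq)
    finally have S: "?S = (m - a) * (b - m) + (?U + ?V)" by (simp only: wm)
    have IH_u: "c * (c + 1) \<le> 2 * ?U"
      "2 * ?U = c * (c + 1) \<longleftrightarrow> (\<exists>s\<in>subtrees u. leaves s = [r..<r + c + 1])"
      using "2.IH"(1)[OF m(3) \<open>a \<le> r\<close>, of c] by (simp_all add: m_eq)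
    have IH_v: "d * (d + 1) \<le> 2 * ?V"
      "2 * ?V = d * (d + 1) \<longleftrightarrow> (\<exists>s\<in>subtrees v. leaves s = [m..<m + d + 1])"
      using "2.IH"(2)[OF m(4) order.refl, of d] \<open>r + k < b\<close> by (simp_all add: m_eq k_eq)
    have ge: "c + 1 \<le> m - a" "d + 1 \<le> b - m"
      using \<open>a \<le> r\<close> \<open>r + k < b\<close> by (simp_all add: m_eq k_eq)
    have root: "(c + 1) * (d + 1) \<le> (m - a) * (b - m)"
      using mult_le_mono[OF ge] .
    \<comment> \<open>Twice the number of pairs among \<open>k + 1\<close> leaves: pairs within the
      left piece, within the right piece, and across the root.\<close>
    have k: "k * (k + 1) = c * (c + 1) + d * (d + 1) + 2 * ((c + 1) * (d + 1))"
      by (simp add: k_eq algebra_simps)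
    \<comment> \<open>Variables stand for the products, which makes both facts linear.\<close>
    have arith: "x1 \<le> 2 * U \<Longrightarrow> x2 \<le> 2 * V \<Longrightarrow> z \<le> w \<Longrightarrow> x1 + x2 + 2 * z \<le> 2 * (w + (U + V))"
      "x1 \<le> 2 * U \<Longrightarrow> x2 \<le> 2 * V \<Longrightarrow> 2 * (w + (U + V)) = x1 + x2 + 2 * z \<Longrightarrow> w \<le> z"
      for x1 x2 U V w z :: nat
      by simp_all
    have "k * (k + 1) \<le> 2 * ?S"
      using IH_u(1) IH_v(1) root unfolding S k by (rule arith(1))
    moreover have "2 * ?S = k * (k + 1) \<longleftrightarrow> (\<exists>s\<in>subtrees ?t. leaves s = [r..<r + k + 1])"
    proof
      assume "2 * ?S = k * (k + 1)"
      then have "(m - a) * (b - m) \<le> (c + 1) * (d + 1)"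
        using arith(2)[OF IH_u(1) IH_v(1)] unfolding S k by blast
      from mult_eq_imp_eq_nat[OF this ge] have "m - a = c + 1" "b - m = d + 1" by simp_all
      then have "a = r" "b = r + k + 1" using m(1,2) by (simp_all add: m_eq k_eq)
      then show "\<exists>s\<in>subtrees ?t. leaves s = [r..<r + k + 1]"
        using \<open>leaves ?t = [a..<b]\<close> subtree_refl by blast
    next
      assume "\<exists>s\<in>subtrees ?t. leaves s = [r..<r + k + 1]"
      then obtain s where s: "s \<in> subtrees ?t" "leaves s = [r..<r + k + 1]" by blast
      \<comment> \<open>Since \<open>r\<close> is a leaf of \<open>u\<close> and \<open>m\<close>
        one of \<open>v\<close>, \<open>s\<close> lies in neither child and is the whole
        tree.\<close>
      have "m \<in> set (leaves s)" "r \<in> set (leaves s)" using 3 unfolding s(2) by (simp_all del: upt_Suc)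
      then have "s \<notin> subtrees u" "s \<notin> subtrees v" using u_sub[of s] v_sub[of s] 3 by fastforce+
      then have "s = ?t" using s(1) by simp
      then have "[a..<b] = [r..<r + k + 1]" using s(2) \<open>leaves ?t = [a..<b]\<close> by simp
      then have "hd [a..<b] = hd [r..<r + k + 1]" "length [a..<b] = length [r..<r + k + 1]"
        by simp_all
      then have ab: "a = r" "b = r + k + 1"
        using m(1,2) by (simp_all del: upt_Suc)
      have "leaves u = [r..<r + c + 1]" "leaves v = [m..<m + d + 1]"
        unfolding m(3,4) ab by (simp_all add: m_eq k_eq add.assoc del: upt_Suc)
      then have "2 * ?U = c * (c + 1)" "2 * ?V = d * (d + 1)"
        using IH_u(2) IH_v(2) subtree_refl by blast+
      moreover have "m - a = c + 1" "b - m = d + 1" by (simp_all add: ab m_eq k_eq)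
      ultimately show "2 * ?S = k * (k + 1)" unfolding S k by (simp only: distrib_left add_ac)
    qed
    ultimately show ?thesis by blast
  qed
qed

section \<open>Contractions preserve leaf sequences\<close>

lemma contract_edge_leaves: "contract_edge t t' \<Longrightarrow> leaves t = leaves t'"
  by (induction rule: contract_edge.induct) auto

text \<open>A contraction removes one vertex, and every surviving vertex keeps its leaves.\<close>

lemma contract_edge_subtree:
  "contract_edge t t' \<Longrightarrow> s' \<in> subtrees t' \<Longrightarrow> \<exists>s\<in>subtrees t. leaves s = leaves s'"
proof (induction arbitrary: s' rule: contract_edge.induct)
  case (here us ts vs)
  then show ?case by auto
next
  case (below t t' us vs)
  have leaves: "leaves t = leaves t'"
    using below.hyps by (rule contract_edge_leaves)
  from below.prems consider "s' = Node (us @ t' # vs)"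
    | "s' \<in> subtrees t'" | u where "u \<in> set us \<union> set vs" "s' \<in> subtrees u"
    by auto
  then show ?case
  proof cases
    case 1
    then show ?thesis using leaves by auto
  next
    case 2
    then show ?thesis using below.IH[OF 2] by auto
  next
    case 3
    then show ?thesis by auto
  qed
qed

lemma refines_subtree:
  assumes "refines t t'" "s' \<in> subtrees t'"
  shows "\<exists>s\<in>subtrees t. leaves s = leaves s'"
  using assms(1)[unfolded refines_def] assms(2)
proof (induction arbitrary: s' rule: rtranclp_induct)
  case base
  then show ?case by blast
next
  case (step t' t'')
  then show ?case using contract_edge_subtree by metis
qed

section \<open>Flattening by contractions\<close>

lemma refines_trans [trans]: "refines t t' \<Longrightarrow> refines t' t'' \<Longrightarrow> refines t t''"
  unfolding refines_def by (rule rtranclp_trans)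

lemma refines_contract: "refines (Node (us @ Node ts # vs)) (Node (us @ ts @ vs))"
  unfolding refines_def by (intro r_into_rtranclp contract_edge.here)

lemma refines_below: "refines t t' \<Longrightarrow> refines (Node (us @ t # vs)) (Node (us @ t' # vs))"
  unfolding refines_def
  by (induction rule: rtranclp_induct) (auto intro: rtranclp.rtrancl_into_rtrancl contract_edge.below)

text \<open>The premise on single children has the shape of the induction hypothesis in
  \<open>refines_flatten_child\<close>.\<close>

lemma refines_flatten_list:
  assumes "\<And>t us vs. t \<in> set ts \<Longrightarrow>
    refines (Node (us @ t # vs)) (Node (us @ map Leaf (leaves t) @ vs))"
  shows "refines (Node (us @ ts @ vs)) (Node (us @ map Leaf (concat (map leaves ts)) @ vs))"
  using assms
proof (induction ts arbitrary: us)
  case Nil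
  then show ?case by (simp add: refines_def)
next
  case (Cons t ts)
  have "refines (Node (us @ t # ts @ vs)) (Node (us @ map Leaf (leaves t) @ ts @ vs))"
    using Cons.prems by simp
  also have "refines \<dots> (Node (us @ map Leaf (leaves t) @ map Leaf (concat (map leaves ts)) @ vs))"
    using Cons.IH[of "us @ map Leaf (leaves t)"] Cons.prems by simp
  finally show ?case by simp
qed

lemma refines_flatten_child:
  "refines (Node (us @ t # vs)) (Node (us @ map Leaf (leaves t) @ vs))"
proof (induction t arbitrary: us vs)
  case (Leaf i)
  then show ?case by (simp add: refines_def)
next
  case (Node ts)
  have "refines (Node (us @ Node ts # vs)) (Node (us @ ts @ vs))"
    by (rule refines_contract)
  also have "refines \<dots> (Node (us @ map Leaf (concat (map leaves ts)) @ vs))"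
    using Node by (rule refines_flatten_list)
  finally show ?case by simp
qed

lemmas refines_flatten = refines_flatten_list[OF refines_flatten_child]

text \<open>The siblings of \<open>t\<close> are flattened completely, while \<open>t\<close> itself
  is flattened around \<open>s\<close>, which stays intact.\<close>

lemma refines_flatten_around_list:
  assumes "t \<in> set ts"
    and "\<exists>xs ys. leaves t = xs @ leaves s @ ys \<and>
      (\<forall>us vs. refines (Node (us @ t # vs)) (Node (us @ map Leaf xs @ s # map Leaf ys @ vs)))"
  shows "\<exists>xs ys. leaves (Node ts) = xs @ leaves s @ ys \<and>
    (\<forall>us vs. refines (Node (us @ ts @ vs)) (Node (us @ map Leaf xs @ s # map Leaf ys @ vs)))"
proof -
  obtain as bs where ts: "ts = as @ t # bs" using assms(1) by (auto simp: in_set_conv_decomp)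
  obtain xs ys where xy: "leaves t = xs @ leaves s @ ys"
    and ref: "\<And>us vs. refines (Node (us @ t # vs)) (Node (us @ map Leaf xs @ s # map Leaf ys @ vs))"
    using assms(2) by blast
  let ?as = "concat (map leaves as)" and ?bs = "concat (map leaves bs)"
  have "refines (Node (us @ ts @ vs))
    (Node (us @ map Leaf (?as @ xs) @ s # map Leaf (ys @ ?bs) @ vs))" for us vs
  proof -
    have "refines (Node (us @ ts @ vs)) (Node (us @ map Leaf ?as @ t # bs @ vs))"
      using refines_flatten[of us as "t # bs @ vs"] ts by simp
    also have "refines \<dots> (Node (us @ map Leaf ?as @ t # map Leaf ?bs @ vs))"
      using refines_flatten[of "us @ map Leaf ?as @ [t]" bs vs] by simp
    also have "refines \<dots> (Node (us @ map Leaf (?as @ xs) @ s # map Leaf (ys @ ?bs) @ vs))"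
      using ref[of "us @ map Leaf ?as" "map Leaf ?bs @ vs"] by simp
    finally show ?thesis .
  qed
  moreover have "leaves (Node ts) = (?as @ xs) @ leaves s @ (ys @ ?bs)" by (simp add: ts xy)
  ultimately show ?thesis by blast
qed

lemma refines_flatten_around_child:
  assumes "s \<in> subtrees t"
  shows "\<exists>xs ys. leaves t = xs @ leaves s @ ys \<and>
    (\<forall>us vs. refines (Node (us @ t # vs)) (Node (us @ map Leaf xs @ s # map Leaf ys @ vs)))"
  using assms
proof (induction t)
  case (Leaf i)
  then show ?case by (auto simp: refines_def intro!: exI[of _ "[]"])
next
  case (Node ts)
  show ?case
  proof (cases "s = Node ts")
    case True
    then show ?thesis by (auto simp: refines_def intro!: exI[of _ "[]"])
  next
    case False
    then obtain t where t: "t \<in> set ts" "s \<in> subtrees t" using Node.prems by auto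
    show ?thesis
      using refines_flatten_around_list[OF t(1) Node.IH[OF t]]
      by (blast intro: refines_trans[OF refines_contract])
  qed
qed

text \<open>The entry following \<open>xs\<close> is \<open>c\<close>, which fixes the length of
  \<open>xs\<close>; this needs the block to be nonempty.\<close>

lemma append_upt_eq:
  assumes "xs @ [c..<d] @ ys = [a..<b]" "c < d"
  shows "xs = [a..<c] \<and> ys = [d..<b]"
proof -
  have len: "length xs + (d - c) + length ys = b - a"
    using arg_cong[OF assms(1), of length] by simp
  have "(xs @ [c..<d] @ ys) ! length xs = c"
    using assms(2) by (simp add: nth_append)
  then have c: "c = a + length xs" unfolding assms(1) using len assms(2) by simp
  have "xs = take (length xs) [a..<b]" "ys = drop (length xs + (d - c)) [a..<b]"
    unfolding assms(1)[symmetric] by simp_all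
  then show ?thesis using len assms(2) by (simp add: c)
qed

text \<open>By \<open>1 \<le> k\<close> the subtree is not a leaf, and by \<open>k < n\<close> it is
  not all of \<open>t\<close>, so there is an internal edge above it to keep.\<close>

lemma refines_y_iff:
  assumes "leaves t = [0..<n + 1]" "1 \<le> k" "k < n"
  shows "refines t (y n r k) \<longleftrightarrow> (\<exists>s\<in>subtrees t. leaves s = [r..<r + k + 1])"
proof
  assume "refines t (y n r k)"
  moreover have "Node (map Leaf [r..<r + k + 1]) \<in> subtrees (y n r k)"
    unfolding y_def by (simp del: upt_Suc)
  moreover have "leaves (Node (map Leaf xs)) = xs" for xs
    by (induction xs) auto
  ultimately show "\<exists>s\<in>subtrees t. leaves s = [r..<r + k + 1]"
    using refines_subtree by metis
next
  assume "\<exists>s\<in>subtrees t. leaves s = [r..<r + k + 1]"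
  then obtain s where s: "s \<in> subtrees t" "leaves s = [r..<r + k + 1]" by blast
  have "length (leaves s) \<noteq> length (leaves t)" "length (leaves s) \<noteq> 1"
    "length (leaves t) \<noteq> 1"
    unfolding s(2) assms(1) using assms(2,3) by simp_all
  then obtain ss ts where Node: "s = Node ss" "t = Node ts" "s \<noteq> t"
    by (cases s; cases t) auto
  then obtain t' where t': "t' \<in> set ts" "s \<in> subtrees t'" using s(1) by auto
  obtain xs ys where xy: "leaves t = xs @ leaves s @ ys"
    and ref: "\<And>us vs. refines (Node (us @ ts @ vs)) (Node (us @ map Leaf xs @ s # map Leaf ys @ vs))"
    using refines_flatten_around_list[OF t'(1) refines_flatten_around_child[OF t'(2)]] Node(2) by blast
  have xy_eq: "xs = [0..<r]" "ys = [r + k + 1..<n + 1]"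
    using append_upt_eq[of xs r "r + k + 1" ys 0 "n + 1"] xy s(2) assms(1) by (simp_all del: upt_Suc)
  have "refines t (Node (map Leaf xs @ s # map Leaf ys))"
    using ref[of "[]" "[]"] Node(2) by simp
  \<comment> \<open>The edges inside \<open>s\<close> are still to be contracted;
    \<open>refines_below\<close> does this in place.\<close>
  also have "refines s (Node (map Leaf [r..<r + k + 1]))"
    using refines_flatten[of "[]" ss "[]"] Node(1) s(2) by (simp del: upt_Suc)
  note refines_below[OF this]
  finally show "refines t (y n r k)"
    unfolding y_def xy_eq by (simp del: upt_Suc)
qed

section \<open>The polynomial at the point of a tree\<close>

lemma p_interval_shuffle_M:
  assumes "k < n" "r + k \<le> n" "t \<in> Y n"
  shows "p n (interval_shuffle n r k) (M n t) =
    real n / 2 * (2 * real (\<Sum>i\<in>{r<..r + k}. vertex_weight t i) - real (k * (k + 1)))"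
proof -
  let ?A = "{r<..r + k}"
  have t: "binary t" "leaves t = [0..<n + 1]" using assms(3) by (auto simp: Y_def)
  have A: "{r + 1..r + k} = ?A" "?A \<subseteq> {0<..n}" "{1..n} = {0<..n}" using assms(2) by auto
  have M: "sum (M n t) B = real (sum (vertex_weight t) B)" if "B \<subseteq> {0<..n}" for B
    unfolding of_nat_sum
    using that by (intro sum.cong) (auto simp: M_def vertex_weight_def Let_def split: prod.splits)
  \<comment> \<open>The equality case for the full interval, where \<open>t\<close> itself is the
    required subtree.\<close>
  have "2 * sum (vertex_weight t) {0<..n} = n * (n + 1)"
    using sum_vertex_weight[OF t order.refl, of n] t(2) subtree_refl[of t] by auto
  then have total: "2 * real (sum (vertex_weight t) {0<..n}) = real n * (real n + 1)"
    by (metis of_nat_1 of_nat_add of_nat_mult of_nat_numeral)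
  have "p n (interval_shuffle n r k) (M n t) =
    (real n - real k) * sum (M n t) ?A - real k * (sum (M n t) {0<..n} - sum (M n t) ?A)
    + 1 / 2 * real n * real k * (real n - real k)"
    unfolding p_def interval_shuffle_def fst_conv snd_conv A(1,3)
    using sum_diff[OF _ A(2), of "M n t"] by (simp add: Let_def)
  also have "\<dots> = real n * sum (M n t) ?A - real k * sum (M n t) {0<..n}
    + 1 / 2 * real n * real k * (real n - real k)"
    by (simp add: algebra_simps)
  also have "sum (M n t) {0<..n} = real n * (real n + 1) / 2"
    using M[OF order.refl] total by simp
  finally show ?thesis
    unfolding M[OF A(2)] by (simp add: field_simps)
qed

theorem proposition2p6:
  fixes n k r :: nat and \<omega> :: "nat set \<times> nat set" and t :: ptree
  assumes "n \<ge> 2" and "1 \<le> k" and "k \<le> n - 1" and "r \<le> n - k"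
    and "\<omega> = interval_shuffle n r k"
    and "t \<in> Y n"
  shows "(M n t \<in> hyperplane n \<omega> \<longleftrightarrow> refines t (y n r k)) \<and>
         (\<not> refines t (y n r k) \<longrightarrow> p n \<omega> (M n t) > 0)"
proof -
  let ?S = "\<Sum>i\<in>{r<..r + k}. vertex_weight t i"
  have bounds: "k < n" "r + k \<le> n" using assms(1,3,4) by simp_all
  have t: "binary t" "leaves t = [0..<n + 1]" using assms(6) by (auto simp: Y_def)
  have S: "k * (k + 1) \<le> 2 * ?S" "2 * ?S = k * (k + 1) \<longleftrightarrow> refines t (y n r k)"
    using sum_vertex_weight[OF t, of r k] refines_y_iff[OF t(2) assms(2) bounds(1), of r] bounds
    by simp_all
  \<comment> \<open>The difference is now taken in \<open>nat\<close>; \<open>S(1)\<close> ensures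
    that it is not truncated.\<close>
  have p: "p n \<omega> (M n t) = real n / 2 * real (2 * ?S - k * (k + 1))"
    using p_interval_shuffle_M[OF bounds assms(6)] S(1) assms(5) by simp
  have "M n t \<in> {1..n} \<rightarrow>\<^sub>E UNIV" by (simp add: M_def)
  then have "M n t \<in> hyperplane n \<omega> \<longleftrightarrow> 2 * ?S = k * (k + 1)"
    using S(1) assms(1)
    unfolding hyperplane_def mem_Collect_eq p mult_eq_0_iff of_nat_eq_0_iff by auto
  moreover have "p n \<omega> (M n t) > 0" if "2 * ?S \<noteq> k * (k + 1)"
  proof -
    have "0 < 2 * ?S - k * (k + 1)" using that S(1) by linarith
    then have "0 < real (2 * ?S - k * (k + 1))" by (simp only: of_nat_0_less_iff)
    moreover have "0 < real n / 2" using assms(1) by simp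
    ultimately show ?thesis unfolding p by (intro mult_pos_pos)
  qed
  ultimately show ?thesis using S(2) by blast
qed

end
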